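(* Let $ABC$ be a triangle with no right angle and let $\ell$ be any admissible transversal of it, meeting the sidelines $BC,CA,AB$ at $D,E,F$ respectively. Let $G,H,I$ be the orthocenters of triangles $AEF$, $BFD$, $CDE$ respectively. Then the lines $AG,BH,CI$ are mutually parallel; consequently $\triangle ABC$ and $\triangle GHI$ are perspective from the point at infinity in the direction orthogonal to $\ell$.
   Context: An admissible transversal of $\triangle ABC$ is a line that passes through no vertex of the triangle and is parallel to no side. Triangles $ABC$ and $GHI$ are perspective from a (possibly infinite) point $P$ if the lines $AG,BH,CI$ all pass through $P$. *)

theory Defs
  imports "HOL-Analysis.Analysis"
begin

type_synonym point = "real ^ 2"

abbreviation line :: "point \<Rightarrow> point \<Rightarrow> point set" where
  "line X Y \<equiv> affine hull {X, Y}"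

definition is_line :: "point set \<Rightarrow> bool" where
  "is_line L \<longleftrightarrow> (\<exists>X Y. X \<noteq> Y \<and> L = line X Y)"

text \<open>Parallelism is taken in the weak sense: a line is parallel to itself.\<close>

definition parallel :: "point set \<Rightarrow> point set \<Rightarrow> bool" where
  "parallel L M \<longleftrightarrow> is_line L \<and> is_line M \<and> affine_parallel L M"

definition is_triangle :: "point \<Rightarrow> point \<Rightarrow> point \<Rightarrow> bool" where
  "is_triangle A B C \<longleftrightarrow> \<not> collinear {A, B, C}"

definition right_angle :: "point \<Rightarrow> point \<Rightarrow> point \<Rightarrow> bool" where
  \<comment> \<open>the vertex of the angle is the middle argument\<close>
  "right_angle X Y Z \<longleftrightarrow> orthogonal (X - Y) (Z - Y)"

definition admissible_transversal :: "point set \<Rightarrow> point \<Rightarrow> point \<Rightarrow> point \<Rightarrow> bool" where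
  "admissible_transversal l A B C \<longleftrightarrow>
     is_line l \<and> A \<notin> l \<and> B \<notin> l \<and> C \<notin> l \<and>
     \<not> parallel l (line B C) \<and> \<not> parallel l (line C A) \<and> \<not> parallel l (line A B)"

definition altitude :: "point \<Rightarrow> point \<Rightarrow> point \<Rightarrow> point set" where
  \<comment> \<open>the altitude through the first argument\<close>
  "altitude A B C = {X. orthogonal (X - A) (C - B)}"

definition orthocenter :: "point \<Rightarrow> point \<Rightarrow> point \<Rightarrow> point" where
  "orthocenter A B C =
     (THE X. X \<in> altitude A B C \<and> X \<in> altitude B C A \<and> X \<in> altitude C A B)"

lemma orthocenter_ex1:
  assumes "is_triangle A B C"
  shows "\<exists>!X. X \<in> altitude A B C \<and> X \<in> altitude B C A \<and> X \<in> altitude C A B"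
proof -
  define d where "d = (B$1 - A$1) * (C$2 - A$2) - (B$2 - A$2) * (C$1 - A$1)"
  have d: "d \<noteq> 0"
  proof
    assume d0: "d = 0"
    have "collinear {A, B, C}"
    proof (cases "B = A")
      case True
      then show ?thesis by simp
    next
      case False
      then have nz: "(B$1 - A$1)\<^sup>2 + (B$2 - A$2)\<^sup>2 \<noteq> 0"
        by (auto simp: vec_eq_iff forall_2 sum_power2_eq_zero_iff)
      define t where "t = ((C$1 - A$1) * (B$1 - A$1) + (C$2 - A$2) * (B$2 - A$2))
                          / ((B$1 - A$1)\<^sup>2 + (B$2 - A$2)\<^sup>2)"
      have "C$1 - A$1 = t * (B$1 - A$1)" "C$2 - A$2 = t * (B$2 - A$2)"
        unfolding t_def using d0 nz unfolding d_def
        by (simp_all add: nonzero_eq_divide_eq nonzero_divide_eq_eq power2_eq_square) algebra+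
      then have "C - A = t *\<^sub>R (B - A)"
        by (simp add: vec_eq_iff forall_2)
      then have "collinear {0, B - A, C - A}"
        by (auto simp: collinear_lemma)
      then have "collinear {B, A, C}"
        by (subst collinear_3) simp
      then show ?thesis by (simp add: insert_commute)
    qed
    with assms show False by (simp add: is_triangle_def)
  qed
  define p where "p = (B - A) \<bullet> (C - A)"
  define X :: point where "X = vector [A$1 + p * (C$2 - B$2) / d, A$2 - p * (C$1 - B$1) / d]"
  have in_alt: "Y \<in> altitude U V W \<longleftrightarrow>
      (Y$1 - U$1) * (W$1 - V$1) + (Y$2 - U$2) * (W$2 - V$2) = 0" for Y U V W :: point
    by (simp add: altitude_def orthogonal_def inner_vec_def sum_2)
  have X: "d * (X$1 - A$1) = p * (C$2 - B$2)" "d * (X$2 - A$2) = - p * (C$1 - B$1)"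
    using d by (simp_all add: X_def)
  have pp: "p = (B$1 - A$1) * (C$1 - A$1) + (B$2 - A$2) * (C$2 - A$2)"
    by (simp add: p_def inner_vec_def sum_2)
  have a1: "X \<in> altitude A B C"
  proof -
    have "d * ((X$1 - A$1) * (C$1 - B$1) + (X$2 - A$2) * (C$2 - B$2)) = 0"
      using X by algebra
    with d show ?thesis by (simp add: in_alt)
  qed
  moreover have a2: "X \<in> altitude B C A"
  proof -
    have "d * ((X$1 - B$1) * (A$1 - C$1) + (X$2 - B$2) * (A$2 - C$2)) = 0"
      using X pp d_def by algebra
    with d show ?thesis by (simp add: in_alt)
  qed
  moreover have "X \<in> altitude C A B"
    using a1 a2 unfolding in_alt by algebra
  moreover have "Y = X" if "Y \<in> altitude A B C" "Y \<in> altitude B C A" for Y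
  proof -
    have "d * (Y$1 - X$1) = 0" "d * (Y$2 - X$2) = 0"
      using that a1 a2 d_def unfolding in_alt by algebra+
    with d show ?thesis by (simp add: vec_eq_iff forall_2)
  qed
  ultimately show ?thesis by blast
qed

text \<open>
  Points of the projectively extended plane. A point at infinity is represented by the
  direction of the lines through it, that is, by their common translate through the origin.
\<close>

datatype ext_point = Finite point | Infinite "point set"

fun passes_through :: "point set \<Rightarrow> ext_point \<Rightarrow> bool" where
  "passes_through L (Finite p) \<longleftrightarrow> p \<in> L"
| "passes_through L (Infinite W) \<longleftrightarrow> subspace W \<and> parallel L W"

definition orthogonal_direction :: "point set \<Rightarrow> point set" where
  "orthogonal_direction L = {v. \<forall>X\<in>L. \<forall>Y\<in>L. orthogonal v (X - Y)}"

text \<open>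
  Only the three joining lines matter for perspectivity (and they have to be lines); the
  points \<open>G, H, I\<close> are allowed to be collinear.
\<close>

definition perspective_from ::
  "ext_point \<Rightarrow> point \<Rightarrow> point \<Rightarrow> point \<Rightarrow> point \<Rightarrow> point \<Rightarrow> point \<Rightarrow> bool" where
  "perspective_from P A B C G H I \<longleftrightarrow>
     A \<noteq> G \<and> B \<noteq> H \<and> C \<noteq> I \<and>
     passes_through (line A G) P \<and> passes_through (line B H) P \<and> passes_through (line C I) P"

end

theory Submission
  imports Defs
begin

text \<open>
  The altitude of triangle \<open>AEF\<close> through \<open>A\<close> is orthogonal to \<open>EF\<close>, that is, to the
  transversal \<open>l\<close>. It contains both \<open>A\<close> and the orthocenter \<open>G\<close>, so it is the line \<open>AG\<close>
  as soon as \<open>A \<noteq> G\<close>. If \<open>A = G\<close>, then the altitude through \<open>E\<close> is \<open>EA\<close>, so the angle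
  of \<open>AEF\<close> at \<open>A\<close> would be right; since \<open>E\<close> and \<open>F\<close> lie on \<open>CA\<close> and \<open>AB\<close> and differ
  from \<open>A\<close>, the angle of \<open>ABC\<close> at \<open>A\<close> would be right as well. Hence \<open>AG\<close> has the
  direction orthogonal to \<open>l\<close> (lemma \<open>vertex_orthocenter_line\<close>). This argument concerns one
  vertex at a time, so it applies to \<open>BH\<close> and \<open>CI\<close> after a cyclic relabelling, and
  lines with a common direction are parallel.
\<close>

lemma line_eq_translate_span: "line X Y = (+) X ` span {Y - X}"
  using affine_hull_insert_span_gen[of X "{Y}"] by simp

lemma mem_line_iff: "Z \<in> line X Y \<longleftrightarrow> (\<exists>t. Z - X = t *\<^sub>R (Y - X))"
proof -
  have "Z \<in> line X Y \<longleftrightarrow> Z - X \<in> span {Y - X}"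
    by (auto simp: line_eq_translate_span intro: image_eqI[where x = "Z - X"])
  then show ?thesis
    by (auto simp: span_singleton)
qed

lemma line_difference:
  assumes "P \<in> line X Y" "Q \<in> line X Y"
  obtains k where "P - Q = k *\<^sub>R (Y - X)"
proof -
  obtain s t where s: "P - X = s *\<^sub>R (Y - X)" and t: "Q - X = t *\<^sub>R (Y - X)"
    using assms by (auto simp: mem_line_iff)
  have "P - Q = (P - X) - (Q - X)"
    by simp
  also have "\<dots> = (s - t) *\<^sub>R (Y - X)"
    by (simp only: s t scaleR_left_diff_distrib)
  finally show thesis
    by (rule that)
qed

lemma parallel_line_span:
  assumes "X \<noteq> Y"
  shows "parallel (line X Y) (span {Y - X})"
proof -
  have "line 0 (Y - X) = span {Y - X}"
    by (simp add: line_eq_translate_span)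
  moreover have "affine_parallel (span {Y - X}) (line X Y)"
    unfolding affine_parallel_def line_eq_translate_span by blast
  moreover have "is_line (line X Y)" "is_line (line 0 (Y - X))"
    using assms unfolding is_line_def by (metis, metis right_minus_eq)
  ultimately show ?thesis
    by (simp add: parallel_def affine_parallel_commute)
qed

lemma parallel_if_common_parallel: "parallel L W \<Longrightarrow> parallel M W \<Longrightarrow> parallel L M"
  unfolding parallel_def by (meson affine_parallel_assoc affine_parallel_commute)

lemma orthogonal_direction_line:
  "orthogonal_direction (line X Y) = {v. orthogonal v (Y - X)}"
proof (intro equalityI subsetI)
  fix v assume "v \<in> orthogonal_direction (line X Y)"
  moreover have "X \<in> line X Y" "Y \<in> line X Y"
    by (simp_all add: hull_inc)
  ultimately show "v \<in> {v. orthogonal v (Y - X)}"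
    by (auto simp: orthogonal_direction_def)
next
  fix v assume v: "v \<in> {v. orthogonal v (Y - X)}"
  have "orthogonal v (P - Q)" if "P \<in> line X Y" "Q \<in> line X Y" for P Q
  proof -
    obtain k where "P - Q = k *\<^sub>R (Y - X)"
      using line_difference[OF \<open>P \<in> line X Y\<close> \<open>Q \<in> line X Y\<close>] .
    with v show ?thesis by (simp add: orthogonal_clauses)
  qed
  then show "v \<in> orthogonal_direction (line X Y)"
    by (simp add: orthogonal_direction_def)
qed

lemma orthogonal_complement_plane:
  fixes g u :: point
  assumes "u \<noteq> 0" "g \<noteq> 0" "orthogonal g u"
  shows "{v. orthogonal v u} = span {g}"
proof (intro equalityI subsetI)
  fix v assume "v \<in> {v. orthogonal v u}"
  then have v: "v$1 * u$1 + v$2 * u$2 = 0"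
    by (simp add: orthogonal_def inner_vec_def sum_2)
  have g: "g$1 * u$1 + g$2 * u$2 = 0"
    using assms(3) by (simp add: orthogonal_def inner_vec_def sum_2)
  \<comment> \<open>The cross product of \<open>g\<close> and \<open>v\<close> vanishes, so \<open>v\<close> is its own projection onto \<open>g\<close>.\<close>
  have "u$1 * (g$1 * v$2 - g$2 * v$1) = 0" "u$2 * (g$1 * v$2 - g$2 * v$1) = 0"
    using v g by algebra+
  with assms(1) have det: "g$1 * v$2 = g$2 * v$1"
    by (auto simp: vec_eq_iff forall_2)
  have "(g \<bullet> g) *\<^sub>R v = (g \<bullet> v) *\<^sub>R g"
    using det by (simp add: vec_eq_iff forall_2 inner_vec_def sum_2) algebra
  then have "v = ((g \<bullet> v) / (g \<bullet> g)) *\<^sub>R g"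
    using assms(2) by (metis inner_eq_zero_iff scaleR_scaleR divide_inverse_commute
        left_inverse scaleR_one)
  then show "v \<in> span {g}"
    by (metis span_base span_scale singletonI)
next
  fix v assume "v \<in> span {g}"
  then show "v \<in> {v. orthogonal v u}"
    using assms(3) by (auto simp: span_singleton orthogonal_clauses)
qed

lemma collinear_iff_differences:
  fixes A B C :: point
  shows "collinear {A, B, C} \<longleftrightarrow> collinear {0, B - A, C - A}"
  by (subst insert_commute, rule collinear_3) simp

lemma orthocenter_in_altitudes:
  assumes "is_triangle A B C"
  shows "orthocenter A B C \<in> altitude A B C" "orthocenter A B C \<in> altitude B C A"
  using theI'[OF orthocenter_ex1[OF assms]] unfolding orthocenter_def by blast+

text \<open>
  Both triangles share the two lines through \<open>A\<close>, and \<open>A \<notin> l\<close> keeps \<open>E\<close> and \<open>F\<close> away from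
  \<open>A\<close>. Hence \<open>AEF\<close> is again a nondegenerate triangle, so that its orthocenter is well
  defined, and its angle at \<open>A\<close> is right exactly when that of \<open>ABC\<close> is.
\<close>

lemma vertex_orthocenter_line:
  assumes tri: "is_triangle A B C" and not_right: "\<not> right_angle B A C"
    and l: "is_line l" "A \<notin> l"
    and E: "E \<in> l" "E \<in> line C A" and F: "F \<in> l" "F \<in> line A B"
    and G: "G = orthocenter A E F"
  shows "A \<noteq> G" "subspace (orthogonal_direction l)"
    "parallel (line A G) (orthogonal_direction l)"
proof -
  have "E \<in> line A C"
    using E(2) by (simp add: insert_commute)
  then obtain s where s: "E - A = s *\<^sub>R (C - A)"
    by (auto simp: mem_line_iff)
  obtain t where t: "F - A = t *\<^sub>R (B - A)"
    using F(2) by (auto simp: mem_line_iff)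
  have "E \<noteq> A" "F \<noteq> A"
    using E(1) F(1) l(2) by auto
  with s t have st: "s \<noteq> 0" "t \<noteq> 0"
    by auto
  have AEF: "is_triangle A E F"
    unfolding is_triangle_def
  proof
    assume "collinear {A, E, F}"
    then have "collinear {0, E - A, F - A}"
      by (simp only: collinear_iff_differences[of A E F])
    then obtain c where "F - A = c *\<^sub>R (E - A)"
      using \<open>E \<noteq> A\<close> \<open>F \<noteq> A\<close> by (auto simp: collinear_lemma)
    then have "t *\<^sub>R (B - A) = (c * s) *\<^sub>R (C - A)"
      using s t by simp
    then have "B - A = (c * s / t) *\<^sub>R (C - A)"
      using st(2) by (metis divide_inverse_commute left_inverse scaleR_one scaleR_scaleR)
    then have "collinear {0, C - A, B - A}"
      by (auto simp: collinear_lemma)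
    then have "collinear {A, B, C}"
      by (simp only: collinear_iff_differences[of A B C] insert_commute)
    with tri show False by (simp add: is_triangle_def)
  qed
  note alt = orthocenter_in_altitudes[OF AEF, folded G]
  show "A \<noteq> G"
  proof
    assume "A = G"
    \<comment> \<open>The altitude through \<open>E\<close>, which contains \<open>G = A\<close>, is orthogonal to \<open>FA\<close>.\<close>
    with alt(2) have "orthogonal (E - A) (F - A)"
      unfolding altitude_def by (simp add: orthogonal_def inner_diff algebra_simps)
    then have "orthogonal (C - A) (B - A)"
      using s t st by (simp add: orthogonal_def)
    with not_right show False
      by (simp add: right_angle_def orthogonal_commute)
  qed
  obtain X Y where XY: "X \<noteq> Y" "l = line X Y"
    using l(1) by (auto simp: is_line_def)
  obtain k where FE: "F - E = k *\<^sub>R (Y - X)"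
    using line_difference[of F X Y E] E(1) F(1) XY(2) by blast
  have "E \<noteq> F"
    using AEF by (auto simp: is_triangle_def)
  have "k \<noteq> 0"
  proof
    assume "k = 0"
    with FE have "F = E" by simp
    with \<open>E \<noteq> F\<close> show False by simp
  qed
  moreover have "orthogonal (G - A) (F - E)"
    using alt(1) by (simp add: altitude_def)
  ultimately have "orthogonal (G - A) (Y - X)"
    unfolding FE by (simp add: orthogonal_def)
  then have W: "orthogonal_direction l = span {G - A}"
    using XY \<open>A \<noteq> G\<close> by (simp add: orthogonal_direction_line orthogonal_complement_plane)
  show "subspace (orthogonal_direction l)"
    by (simp add: W)
  show "parallel (line A G) (orthogonal_direction l)"
    using parallel_line_span[OF \<open>A \<noteq> G\<close>] by (simp add: W)
qed

theorem theorem4p4: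
  fixes A B C D E F G H I :: point and l :: "point set"
  assumes "is_triangle A B C"
    and "\<not> right_angle B A C" and "\<not> right_angle A B C" and "\<not> right_angle A C B"
    and "admissible_transversal l A B C"
    and "l \<inter> line B C = {D}" and "l \<inter> line C A = {E}" and "l \<inter> line A B = {F}"
    and "G = orthocenter A E F" and "H = orthocenter B F D" and "I = orthocenter C D E"
  shows "parallel (line A G) (line B H) \<and> parallel (line B H) (line C I) \<and>
         parallel (line A G) (line C I) \<and>
         perspective_from (Infinite (orthogonal_direction l)) A B C G H I"
proof -
  have l: "is_line l" "A \<notin> l" "B \<notin> l" "C \<notin> l"
    using assms(5) by (auto simp: admissible_transversal_def)
  have D: "D \<in> l" "D \<in> line B C" and E: "E \<in> l" "E \<in> line C A" and F: "F \<in> l" "F \<in> line A B"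
    using assms(6-8) by blast+
  have tri: "is_triangle B C A" "is_triangle C A B"
    using assms(1) by (simp_all add: is_triangle_def insert_commute)
  have angles: "\<not> right_angle C B A" "\<not> right_angle A C B"
    using assms(3,4) by (simp_all add: right_angle_def orthogonal_commute)
  note AG = vertex_orthocenter_line[OF assms(1,2) l(1,2) E F assms(9)]
  note BH = vertex_orthocenter_line[OF tri(1) angles(1) l(1,3) F D assms(10)]
  note CI = vertex_orthocenter_line[OF tri(2) angles(2) l(1,4) D E assms(11)]
  show ?thesis
    using AG BH CI by (auto simp: perspective_from_def intro: parallel_if_common_parallel)
qed

end
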